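(* Let $b,c,\rho,\nu,\mu\in\mathbb{C}$ with $\operatorname{Re}(\rho)>0$, $\operatorname{Re}(\nu)>-1$, $\operatorname{Re}(\mu)>-1$, $\mu\neq\nu$, and let $z\in\mathbb{C}\setminus(-\infty,0]$. Then $$G_\nu^{(b,c)}(z;\rho)=\frac{\Gamma(\mu+1)}{[\Gamma(\nu+1)]^2}\sum_{m=0}^\infty\sum_{n=0}^\infty\Big(\frac z2\Big)^{\nu-\mu+m+n}\frac{(-1)^n J_{\mu+m+n}(z)\,(-m-n)_n\,(-b)^n\,(c;\rho)_{\nu+2n}\,(\mu+1)_n}{(m+n)!\;n!\;(\nu+1)_n\,(\nu+1)_{2n}} .$$
   Context: For $\rho\in\mathbb{C}$ with $\operatorname{Re}(\rho)>0$ and $x\in\mathbb{C}$ put $\Gamma_\rho(x)=\int_0^\infty t^{x-1}e^{-t-\rho/t}\,dt$. The generalized Pochhammer symbol is $(\lambda;\rho)_\nu:=\Gamma_\rho(\lambda+\nu)/\Gamma(\lambda)$, where $1/\Gamma$ is read as an entire function. The unified four parameter Bessel function is $$G_\nu^{(b,c)}(z;\rho):=\sum_{k=0}^\infty \frac{(-b)^k (c;\rho)_{2k+\nu}}{\Gamma(\nu+k+1)\,\Gamma(\nu+2k+1)}\,\frac{(z/2)^{2k+\nu}}{k!}.$$ Complex powers are principal. $(a)_n=a(a+1)\cdots(a+n-1)$, $(a)_0=1$, is the usual Pochhammer symbol, and $J_\nu(z)=\sum_{k=0}^\infty\frac{(-1)^k}{k!\,\Gamma(\nu+k+1)}(z/2)^{2k+\nu}$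 is the usual Bessel function of the first kind. *)

theory Defs
  imports "HOL-Analysis.Analysis"
begin

definition Gamma_rho :: "complex \<Rightarrow> complex \<Rightarrow> complex" where
  "Gamma_rho \<rho> x =
     (LINT t:{0<..}|lborel. complex_of_real t powr (x - 1) *
        exp (- complex_of_real t - \<rho> / complex_of_real t))"

(* Here and below rGamma is the entire function 1/Gamma, so factors 1/Gamma vanish at poles of Gamma. *)
definition gen_pochhammer :: "complex \<Rightarrow> complex \<Rightarrow> complex \<Rightarrow> complex" where
  "gen_pochhammer c \<rho> \<nu> = Gamma_rho \<rho> (c + \<nu>) * rGamma c"

definition bessel_J :: "complex \<Rightarrow> complex \<Rightarrow> complex" where
  "bessel_J \<nu> z =
     (\<Sum>k. (-1) ^ k * rGamma (\<nu> + of_nat k + 1) / fact k * (z / 2) powr (2 * of_nat k + \<nu>))"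

definition unified_bessel_term ::
  "complex \<Rightarrow> complex \<Rightarrow> complex \<Rightarrow> complex \<Rightarrow> complex \<Rightarrow> nat \<Rightarrow> complex" where
  "unified_bessel_term b c \<rho> \<nu> z k =
     ((- b) ^ k * gen_pochhammer c \<rho> (2 * of_nat k + \<nu>)) *
     rGamma (\<nu> + of_nat k + 1) * rGamma (\<nu> + 2 * of_nat k + 1) *
     ((z / 2) powr (2 * of_nat k + \<nu>) / fact k)"

definition unified_bessel ::
  "complex \<Rightarrow> complex \<Rightarrow> complex \<Rightarrow> complex \<Rightarrow> complex \<Rightarrow> complex" where
  "unified_bessel b c \<rho> \<nu> z = (\<Sum>k. unified_bessel_term b c \<rho> \<nu> z k)"

definition double_series_term ::
  "complex \<Rightarrow> complex \<Rightarrow> complex \<Rightarrow> complex \<Rightarrow> complex \<Rightarrow> complex \<Rightarrow> nat \<Rightarrow> nat \<Rightarrow> complex" where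
  "double_series_term b c \<rho> \<nu> \<mu> z m n =
     (z / 2) powr (\<nu> - \<mu> + of_nat m + of_nat n) *
     ((-1) ^ n * bessel_J (\<mu> + of_nat m + of_nat n) z *
        pochhammer (- of_nat m - of_nat n) n * (- b) ^ n *
        gen_pochhammer c \<rho> (\<nu> + 2 * of_nat n) * pochhammer (\<mu> + 1) n) /
     (fact (m + n) * fact n * pochhammer (\<nu> + 1) n * pochhammer (\<nu> + 1) (2 * n))"

end

theory Submission
  imports Defs
begin

text \<open>
  Write \<open>w = z / 2\<close>. Since \<open>(-1)^n (-m-n)_n = (m+n)! / m!\<close>, the double series has the terms
  \<open>C n * (w^m / m! * J_{\<mu>+n+m}(z))\<close>, where \<open>C n\<close> does not involve \<open>m\<close>. Hence the sum over \<open>m\<close>, which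
  is the outer one in the statement, is easy: it is the classical expansion of a power in Bessel
  functions,
  \<open>(\<Sum>m. w^m / m! * J_{\<alpha>+m}(z)) = w^\<alpha> / \<Gamma>(\<alpha>+1)\<close> (lemma \<open>bessel_J_shift_sums\<close>),
  at \<open>\<alpha> = \<mu> + n\<close>. The factor \<open>1 / \<Gamma>(\<mu>+n+1)\<close> cancels \<open>(\<mu>+1)_n\<close> up to \<open>\<Gamma>(\<mu>+1)\<close>, and what remains
  is the \<open>n\<close>-th term of the series of the unified Bessel function.

  So the theorem reduces to exchanging the two summations, that is, to absolute convergence of
  the double series. There is a lot of room: the factor \<open>1 / (m! n!)\<close> beats any geometric growth,
  so it is enough that every other factor is bounded by a geometric one.
  For a quotient of two Pochhammer symbols this holds because the quotients of their factors are
  bounded (\<open>norm_pochhammer_le\<close>). The shifted Bessel functions are bounded by geometric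
  sequences because \<open>1 / \<Gamma>\<close> is bounded along \<open>\<mu> + 1 + \<nat>\<close>
  (\<open>norm_bessel_J_shift_le\<close>), and \<open>\<Gamma>_\<rho>\<close> is dominated by a shifted Gamma function
  (\<open>norm_Gamma_rho_le\<close>), which makes the generalized Pochhammer symbol comparable with an ordinary
  one (\<open>gen_pochhammer_growth\<close>).
\<close>

section \<open>Double series\<close>

lemma product_majorant_summable_on:
  fixes F :: "nat \<Rightarrow> nat \<Rightarrow> 'a::banach"
  assumes F: "\<And>m n. norm (F m n) \<le> f m * g n"
    and f: "summable f" "\<And>m. f m \<ge> 0" and g: "summable g" "\<And>n. g n \<ge> 0"
  shows "(\<lambda>(m, n). F m n) summable_on UNIV \<times> UNIV"
proof -
  have f': "f summable_on UNIV" and g': "g summable_on UNIV"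
    using f g by (auto intro!: norm_summable_imp_summable_on)
  have "(\<lambda>(m, n). f m * g n) summable_on UNIV \<times> UNIV"
    by (rule summable_on_SigmaI[where g = "\<lambda>m. f m * infsum g UNIV"])
       (use f g f' g' in \<open>auto intro!: has_sum_cmult_right has_sum_infsum
          summable_on_cmult_left\<close>)
  then have "(\<lambda>p. norm (case p of (m, n) \<Rightarrow> F m n)) summable_on UNIV \<times> UNIV"
    by (rule Infinite_Sum.abs_summable_on_comparison_test') (use F in auto)
  then show ?thesis
    by (rule abs_summable_summable)
qed

lemma iterated_sums:
  fixes F :: "nat \<Rightarrow> nat \<Rightarrow> 'a::banach"
  assumes F: "(\<lambda>(m, n). F m n) summable_on UNIV \<times> UNIV"
  shows "summable (F m)"
    and "(\<lambda>m. \<Sum>n. F m n) sums (\<Sum>\<^sub>\<infinity>(m, n)\<in>UNIV \<times> UNIV. F m n)"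
proof -
  have row: "F m summable_on UNIV" for m
  proof -
    have "(\<lambda>(m, n). F m n) summable_on Pair m ` UNIV"
      by (rule summable_on_subset_banach[OF F]) auto
    then show ?thesis
      by (subst (asm) summable_on_reindex) (auto simp: o_def inj_on_def)
  qed
  then show "summable (F m)"
    by (rule summable_on_imp_summable)
  have row_sum: "(\<Sum>n. F m n) = (\<Sum>\<^sub>\<infinity>n. F m n)" for m
    using has_sum_imp_sums[OF has_sum_infsum[OF row]] by (simp add: sums_iff)
  have "(\<lambda>m. \<Sum>\<^sub>\<infinity>n. F m n) summable_on UNIV"
    by (rule summable_on_Sigma_banach[OF F])
  from has_sum_imp_sums[OF has_sum_infsum[OF this]]
  show "(\<lambda>m. \<Sum>n. F m n) sums (\<Sum>\<^sub>\<infinity>(m, n)\<in>UNIV \<times> UNIV. F m n)"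
    by (simp add: row_sum infsum_Sigma'_banach[OF F])
qed

lemma iterated_sums_swap:
  fixes F :: "nat \<Rightarrow> nat \<Rightarrow> 'a::banach"
  assumes F: "(\<lambda>(m, n). F m n) summable_on UNIV \<times> UNIV"
  shows "(\<lambda>n. \<Sum>m. F m n) sums (\<Sum>m. \<Sum>n. F m n)"
proof -
  have F': "(\<lambda>(n, m). F m n) summable_on UNIV \<times> UNIV"
    using summable_on_swap[of "\<lambda>(m, n). F m n" UNIV UNIV] F by (simp add: case_prod_unfold)
  have "(\<Sum>\<^sub>\<infinity>(n, m)\<in>UNIV \<times> UNIV. F m n) = (\<Sum>\<^sub>\<infinity>(m, n)\<in>UNIV \<times> UNIV. F m n)"
    using infsum_swap_banach[OF F] infsum_Sigma'_banach[OF F] infsum_Sigma'_banach[OF F'] by simp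
  then show ?thesis
    using iterated_sums(2)[OF F'] iterated_sums(2)[OF F] by (simp add: sums_iff)
qed

text \<open>
  On the antidiagonal \<open>m + k = N\<close> the value \<open>h N\<close> is a common factor, and by the binomial theorem the
  coefficients sum to \<open>(y - y)^N / N!\<close>, so only \<open>N = 0\<close> survives. Boundedness of \<open>h\<close> makes the double
  series absolutely convergent, which permits summation by antidiagonals.
\<close>
lemma antidiagonal_collapse:
  fixes h :: "nat \<Rightarrow> complex"
  assumes h: "\<And>j. norm (h j) \<le> R"
  shows "(\<lambda>m. \<Sum>k. y ^ m / fact m * ((- y) ^ k / fact k) * h (m + k)) sums h 0"
proof -
  define F where "F m k = y ^ m / fact m * ((- y) ^ k / fact k) * h (m + k)" for m k
  have R: "R \<ge> 0"
    using h[of 0] norm_ge_zero[of "h 0"] by linarith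
  have se: "summable (\<lambda>m. norm y ^ m / fact m)"
    using summable_exp[of "norm y"] by (simp add: field_simps)
  have F: "(\<lambda>(m, k). F m k) summable_on UNIV \<times> UNIV"
  proof (rule product_majorant_summable_on)
    show "norm (F m k) \<le> norm y ^ m / fact m * (R * (norm y ^ k / fact k))" for m k
    proof -
      have "norm (F m k) = norm y ^ m / fact m * (norm y ^ k / fact k) * norm (h (m + k))"
        by (simp add: F_def norm_mult norm_divide norm_power)
      also have "\<dots> \<le> norm y ^ m / fact m * (norm y ^ k / fact k) * R"
        by (intro mult_left_mono h) auto
      finally show ?thesis
        by (simp add: mult_ac)
    qed
    show "summable (\<lambda>k. R * (norm y ^ k / fact k))"
      by (rule summable_mult[OF se])
  qed (use R se in auto)
  have reindex: "(\<lambda>(N, m). F m (N - m)) summable_on (SIGMA N:UNIV. {..N}) \<longleftrightarrow>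
      (\<lambda>(m, k). F m k) summable_on UNIV \<times> UNIV"
    by (rule summable_on_reindex_bij_witness[of _ "\<lambda>(m, k). (m + k, m)" "\<lambda>(N, m). (m, N - m)"])
       auto
  have "(\<Sum>\<^sub>\<infinity>(m, k)\<in>UNIV \<times> UNIV. F m k) = (\<Sum>\<^sub>\<infinity>(N, m)\<in>(SIGMA N:UNIV. {..N}). F m (N - m))"
    by (rule infsum_reindex_bij_witness[of _ "\<lambda>(N, m). (m, N - m)" "\<lambda>(m, k). (m + k, m)"])
       auto
  also have "\<dots> = (\<Sum>\<^sub>\<infinity>N. \<Sum>\<^sub>\<infinity>m\<in>{..N}. F m (N - m))"
    by (rule infsum_Sigma'_banach[symmetric]) (use reindex F in simp)
  also have "\<dots> = (\<Sum>\<^sub>\<infinity>N::nat. if N = 0 then h 0 else 0)"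
  proof (rule infsum_cong)
    fix N :: nat
    have "(\<Sum>m\<le>N. y ^ m / fact m * ((- y) ^ (N - m) / fact (N - m))) = (y + - y) ^ N / fact N"
      using exp_series_add_commuting[of y "- y" N]
      by (simp add: scaleR_conv_of_real field_simps)
    moreover have "(\<Sum>m\<le>N. F m (N - m)) =
        (\<Sum>m\<le>N. y ^ m / fact m * ((- y) ^ (N - m) / fact (N - m))) * h N"
      unfolding F_def sum_distrib_right by (rule sum.cong) auto
    ultimately show "(\<Sum>\<^sub>\<infinity>m\<in>{..N}. F m (N - m)) = (if N = 0 then h 0 else 0)"
      by simp
  qed
  also have "\<dots> = (\<Sum>\<^sub>\<infinity>N\<in>{0}. h N)"
    by (rule infsum_cong_neutral) auto
  finally show ?thesis
    using iterated_sums(2)[OF F] by (simp add: F_def)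
qed

section \<open>Growth of Pochhammer symbols and Gamma functions\<close>

lemma power_fact_le_exp:
  fixes u :: real
  assumes "u \<ge> 0"
  shows "u ^ n / fact n \<le> exp u"
  using sum_le_suminf[OF summable_exp[of u], of "{n}"] assms by (simp add: exp_def field_simps)

text \<open>
  Each factor satisfies \<open>\<bar>s + i\<bar> \<le> \<bar>s - w\<bar> + \<bar>w + i\<bar>\<close>, and \<open>\<bar>w + i\<bar> \<ge> Re w\<close>, so the ratio of
  corresponding factors is bounded uniformly in \<open>i\<close>.
\<close>
lemma norm_pochhammer_le:
  fixes s w :: complex
  assumes "Re w > 0"
  shows "norm (pochhammer s n) \<le> (1 + norm (s - w) / Re w) ^ n * norm (pochhammer w n)"
proof (induction n)
  case (Suc n)
  have "Re w \<le> norm (w + of_nat n)"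
    using complex_Re_le_cmod[of "w + of_nat n"] by simp
  then have "norm (s - w) * Re w \<le> norm (s - w) * norm (w + of_nat n)"
    by (rule mult_left_mono) simp
  then have "norm (s - w) \<le> norm (s - w) / Re w * norm (w + of_nat n)"
    using assms by (simp add: field_simps)
  moreover have "norm (s + of_nat n) \<le> norm (s - w) + norm (w + of_nat n)"
    using norm_triangle_ineq[of "s - w" "w + of_nat n"] by simp
  ultimately have "norm (s + of_nat n) \<le> (1 + norm (s - w) / Re w) * norm (w + of_nat n)"
    by (simp add: algebra_simps)
  from mult_mono[OF Suc.IH this] show ?case
    using assms by (simp add: pochhammer_Suc norm_mult mult_ac)
qed simp

lemma pochhammer_nonzero:
  fixes w :: complex
  assumes "Re w > 0"
  shows "pochhammer w n \<noteq> 0"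
proof
  assume "pochhammer w n = 0"
  then obtain k where "w = - of_nat k"
    by (auto simp: pochhammer_eq_0_iff)
  with assms show False
    by simp
qed

lemma rGamma_shift:
  fixes w :: complex
  assumes "Re w > 0"
  shows "rGamma (w + of_nat n) = rGamma w / pochhammer w n"
  using pochhammer_rGamma[of w n] pochhammer_nonzero[OF assms, of n] by (simp add: field_simps)

text \<open>
  Comparing \<open>n! = (1)_n\<close> with \<open>(w)_n\<close> gives \<open>1 / \<bar>(w)_n\<bar> \<le> A^n / n!\<close> for a constant \<open>A\<close>, and the
  right-hand side is at most \<open>exp A\<close>.
\<close>
lemma rGamma_shift_bounded:
  fixes w :: complex
  assumes w: "Re w > 0"
  obtains R where "\<And>n. norm (rGamma (w + of_nat n)) \<le> R"
proof
  define A where "A = 1 + norm (1 - w) / Re w"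
  fix n
  have p: "norm (pochhammer w n) > 0"
    using pochhammer_nonzero[OF w] by simp
  have "norm (pochhammer 1 n :: complex) = fact n"
    by (simp flip: pochhammer_fact)
  then have "fact n \<le> A ^ n * norm (pochhammer w n)"
    using norm_pochhammer_le[OF w, of 1 n] by (simp add: A_def)
  then have "1 / norm (pochhammer w n) \<le> A ^ n / fact n"
    using p by (simp add: field_simps)
  also have "\<dots> \<le> exp A"
    by (rule power_fact_le_exp) (use w in \<open>simp add: A_def\<close>)
  finally have "norm (rGamma w) * (1 / norm (pochhammer w n)) \<le> norm (rGamma w) * exp A"
    by (rule mult_left_mono) simp
  then show "norm (rGamma (w + of_nat n)) \<le> norm (rGamma w) * exp A"
    by (simp add: rGamma_shift[OF w] norm_divide)
qed

text \<open>
  The factor \<open>exp (- \<rho> / t)\<close> makes the integral converge at \<open>0\<close> for every \<open>x\<close>. Quantitatively,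
  \<open>exp u \<ge> u^M / M!\<close> at \<open>u = Re \<rho> / t\<close> bounds it by \<open>M! * (t / Re \<rho>)^M\<close>, and the extra power
  \<open>t^M\<close> moves the argument of the Gamma integral into the right half-plane.
\<close>
lemma norm_Gamma_rho_le:
  assumes a: "Re \<rho> > 0" and s: "Re x + of_nat M > 0"
  shows "norm (Gamma_rho \<rho> x) \<le> fact M / Re \<rho> ^ M * Gamma (Re x + of_nat M)"
proof -
  define s where "s = Re x + of_nat M"
  define G where "G t = indicator {0..} t * t powr (s - 1) / exp t" for t :: real
  have s0: "s > 0"
    using s by (simp add: s_def)
  have "has_bochner_integral lborel G (Gamma s)"
  proof (rule has_bochner_integral_nn_integral)
    show "G \<in> borel_measurable lborel"
      unfolding G_def by measurable
    show "(\<integral>\<^sup>+t. ennreal (G t) \<partial>lborel) = ennreal (Gamma s)"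
      unfolding G_def using Gamma_conv_nn_integral_real[OF s0] by simp
    show "AE t in lborel. 0 \<le> G t"
      by (simp add: G_def)
    show "0 \<le> Gamma s"
      using Gamma_real_pos[OF s0] by simp
  qed
  then have G: "integrable lborel (\<lambda>t. fact M / Re \<rho> ^ M * G t)"
    "(LINT t|lborel. fact M / Re \<rho> ^ M * G t) = fact M / Re \<rho> ^ M * Gamma s"
    by (auto simp: has_bochner_integral_iff)
  let ?f = "\<lambda>t::real. indicator {0<..} t *\<^sub>R (complex_of_real t powr (x - 1) *
        exp (- complex_of_real t - \<rho> / complex_of_real t))"
  have "norm (Gamma_rho \<rho> x) \<le> (LINT t|lborel. norm (?f t))"
    unfolding Gamma_rho_def set_lebesgue_integral_def by (rule integral_norm_bound)
  also have "\<dots> \<le> (LINT t|lborel. fact M / Re \<rho> ^ M * G t)"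
  proof (rule integral_mono'[OF G(1)])
    fix t :: real
    show "0 \<le> fact M / Re \<rho> ^ M * G t"
      using a by (simp add: G_def)
    show "norm (?f t) \<le> fact M / Re \<rho> ^ M * G t"
    proof (cases "t > 0")
      case True
      define u where "u = Re \<rho> / t"
      have u: "u > 0"
        using True a by (simp add: u_def)
      have "u ^ M / fact M \<le> exp u"
        by (rule power_fact_le_exp) (use u in simp)
      then have "exp (- u) \<le> fact M / u ^ M"
        using u by (simp add: exp_minus field_simps)
      also have "\<dots> = fact M / Re \<rho> ^ M * t powr M"
        using True by (simp add: u_def power_divide powr_realpow)
      finally have *: "exp (- u) \<le> fact M / Re \<rho> ^ M * t powr M" .
      have "norm (?f t) = t powr (Re x - 1) * (exp (- t) * exp (- u))"
        using True by (simp add: norm_mult norm_powr_real_powr u_def flip: exp_add)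
      also have "\<dots> \<le> t powr (Re x - 1) * (exp (- t) * (fact M / Re \<rho> ^ M * t powr M))"
        by (intro mult_left_mono *) auto
      also have "\<dots> = fact M / Re \<rho> ^ M * ((t powr (Re x - 1) * t powr M) * exp (- t))"
        by (simp add: mult_ac)
      also have "t powr (Re x - 1) * t powr M = t powr (s - 1)"
        by (simp add: s_def algebra_simps flip: powr_add)
      also have "fact M / Re \<rho> ^ M * (t powr (s - 1) * exp (- t)) = fact M / Re \<rho> ^ M * G t"
        using True by (simp add: G_def exp_minus field_simps)
      finally show ?thesis .
    next
      case False
      then show ?thesis
        using a by (simp add: G_def)
    qed
  qed
  finally show ?thesis
    unfolding G(2) by (simp add: s_def)
qed

text \<open>
  With \<open>s = Re (c + \<nu>) + M > 0\<close>, the bound for \<open>\<Gamma>_\<rho>(c + \<nu> + n)\<close> is a constant multiple of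
  \<open>\<Gamma>(s + n) = \<Gamma>(s) (s)_n\<close>, and \<open>(s)_n\<close> can be compared with \<open>(w)_n\<close>. The exponent \<open>M\<close> depends only on
  \<open>c + \<nu>\<close>, so the constants are uniform in \<open>n\<close>.
\<close>
lemma gen_pochhammer_growth:
  assumes a: "Re \<rho> > 0" and w: "Re w > 0"
  obtains K A where "K \<ge> 0" "A \<ge> 0"
    "\<And>n. norm (gen_pochhammer c \<rho> (\<nu> + of_nat n)) \<le> K * A ^ n * norm (pochhammer w n)"
proof -
  obtain M :: nat where M: "- Re (c + \<nu>) < of_nat M"
    using reals_Archimedean2 by blast
  define s where "s = Re (c + \<nu>) + of_nat M"
  have s: "s > 0"
    using M by (simp add: s_def)
  define A where "A = 1 + norm (of_real s - w) / Re w"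
  define K where "K = fact M / Re \<rho> ^ M * Gamma s * norm (rGamma c)"
  have G: "Gamma s > 0"
    by (rule Gamma_real_pos[OF s])
  have K: "K \<ge> 0"
    using a G by (simp add: K_def)
  have A: "A \<ge> 0"
    using w by (simp add: A_def)
  have "norm (gen_pochhammer c \<rho> (\<nu> + of_nat n)) \<le> K * A ^ n * norm (pochhammer w n)" for n
  proof -
    have "s \<notin> \<int>\<^sub>\<le>\<^sub>0"
      using s nonpos_Ints_nonpos by fastforce
    then have "Gamma (s + of_nat n) = Gamma s * pochhammer s n"
      using pochhammer_Gamma[of s n] G by (simp add: field_simps)
    moreover have "pochhammer s n = norm (pochhammer (complex_of_real s) n)"
      using pochhammer_pos[OF s, of n] by (simp add: pochhammer_of_real)
    ultimately have "Gamma (s + of_nat n) \<le> Gamma s * (A ^ n * norm (pochhammer w n))"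
      using norm_pochhammer_le[OF w, of "of_real s" n] G by (simp add: A_def)
    then have *: "fact M / Re \<rho> ^ M * Gamma (s + of_nat n)
        \<le> fact M / Re \<rho> ^ M * (Gamma s * (A ^ n * norm (pochhammer w n)))"
      using a by (intro mult_left_mono) auto
    have "norm (Gamma_rho \<rho> (c + (\<nu> + of_nat n))) \<le> fact M / Re \<rho> ^ M * Gamma (s + of_nat n)"
      using norm_Gamma_rho_le[OF a, of "c + (\<nu> + of_nat n)" M] s by (simp add: s_def add_ac)
    also note *
    finally have "norm (Gamma_rho \<rho> (c + (\<nu> + of_nat n))) * norm (rGamma c)
        \<le> fact M / Re \<rho> ^ M * (Gamma s * (A ^ n * norm (pochhammer w n))) * norm (rGamma c)"
      by (rule mult_right_mono) simp
    then show ?thesis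
      by (simp add: gen_pochhammer_def norm_mult K_def mult_ac)
  qed
  with K A that show thesis
    by blast
qed

section \<open>Bessel functions\<close>

lemma powr_add_nat:
  fixes w :: complex
  assumes "w \<noteq> 0"
  shows "w powr (a + of_nat n) = w powr a * w ^ n"
  using assms by (simp add: powr_add powr_nat')

lemma bessel_J_power_series:
  assumes "z \<noteq> 0"
  shows "bessel_J \<alpha> z =
    (\<Sum>k. (z / 2) powr \<alpha> * ((- ((z / 2)\<^sup>2)) ^ k / fact k * rGamma (\<alpha> + 1 + of_nat k)))"
proof -
  have "(z / 2) powr (2 * of_nat k + \<alpha>) = (z / 2) powr \<alpha> * ((z / 2)\<^sup>2) ^ k" for k
    using powr_add_nat[of "z / 2" \<alpha> "2 * k"] assms by (simp add: add.commute power_mult)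
  moreover have "(- ((z / 2)\<^sup>2)) ^ k = (-1) ^ k * ((z / 2)\<^sup>2) ^ k" for k
    by (rule power_minus)
  ultimately show ?thesis
    unfolding bessel_J_def by (simp add: add_ac mult_ac)
qed

lemma bessel_series_summable:
  fixes y :: complex
  assumes "\<And>j. norm (h j) \<le> R"
  shows "summable (\<lambda>k. norm (y ^ k / fact k * h k))"
    and "norm (\<Sum>k. y ^ k / fact k * h k) \<le> exp (norm y) * R"
proof -
  have b: "norm (norm (y ^ k / fact k * h k)) \<le> norm y ^ k / fact k * R" for k
    using mult_left_mono[OF assms[of k], of "norm y ^ k / fact k"]
    by (simp add: norm_mult norm_divide norm_power)
  have s: "(\<lambda>k. norm y ^ k / fact k * R) sums (exp (norm y) * R)"
    using sums_mult2[OF exp_converges[of "norm y"], of R] by (simp add: field_simps)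
  show "summable (\<lambda>k. norm (y ^ k / fact k * h k))"
    by (rule summable_comparison_test'[OF sums_summable[OF s] b])
  show "norm (\<Sum>k. y ^ k / fact k * h k) \<le> exp (norm y) * R"
    using norm_suminf_le[of "\<lambda>k. y ^ k / fact k * h k" "\<lambda>k. norm y ^ k / fact k * R"] b s
    by (simp only: sums_iff real_norm_def abs_norm_cancel)
qed

lemma norm_bessel_J_shift_le:
  assumes z: "z \<noteq> 0" and R: "\<And>j. norm (rGamma (\<mu> + 1 + of_nat j)) \<le> R"
  shows "norm (bessel_J (\<mu> + of_nat p) z)
    \<le> norm ((z / 2) powr \<mu>) * norm (z / 2) ^ p * (exp (norm ((z / 2)\<^sup>2)) * R)"
proof -
  have h: "norm (rGamma (\<mu> + of_nat p + 1 + of_nat k)) \<le> R" for k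
    using R[of "p + k"] by (simp add: add_ac)
  have "bessel_J (\<mu> + of_nat p) z = (z / 2) powr \<mu> * (z / 2) ^ p *
      (\<Sum>k. (- ((z / 2)\<^sup>2)) ^ k / fact k * rGamma (\<mu> + of_nat p + 1 + of_nat k))"
  proof -
    have "z / 2 \<noteq> 0"
      using z by simp
    from powr_add_nat[OF this] show ?thesis
      unfolding bessel_J_power_series[OF z]
      by (simp only: suminf_mult[OF summable_norm_cancel[OF bessel_series_summable(1)[OF h]]])
  qed
  also have "norm \<dots> \<le> norm ((z / 2) powr \<mu>) * norm (z / 2) ^ p * (exp (norm ((z / 2)\<^sup>2)) * R)"
    using bessel_series_summable(2)[OF h, of "- ((z / 2)\<^sup>2)"]
    by (simp only: norm_mult norm_power norm_minus_cancel) (intro mult_left_mono; simp)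
  finally show ?thesis .
qed

text \<open>
  Inserting the power series of each \<open>J_{\<alpha>+m}\<close> turns the left-hand side into \<open>(z/2)^\<alpha>\<close> times the double
  series of \<open>antidiagonal_collapse\<close> at \<open>y = (z/2)^2\<close> and \<open>h j = 1 / \<Gamma>(\<alpha> + 1 + j)\<close>, because the
  argument of the reciprocal Gamma function depends on \<open>m + k\<close> only.
\<close>
lemma bessel_J_shift_sums:
  assumes z: "z \<noteq> 0" and l: "Re \<alpha> > -1"
  shows "(\<lambda>m. (z / 2) ^ m / fact m * bessel_J (\<alpha> + of_nat m) z) sums
    ((z / 2) powr \<alpha> * rGamma (\<alpha> + 1))"
proof -
  define w where "w = z / 2"
  have w: "w \<noteq> 0"
    using z by (simp add: w_def)
  define h where "h j = rGamma (\<alpha> + 1 + of_nat j)" for j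
  obtain R where R: "\<And>j. norm (h j) \<le> R"
    using rGamma_shift_bounded[of "\<alpha> + 1"] l unfolding h_def by auto
  have rows: "w ^ m / fact m * bessel_J (\<alpha> + of_nat m) z =
      w powr \<alpha> * (\<Sum>k. (w\<^sup>2) ^ m / fact m * ((- (w\<^sup>2)) ^ k / fact k) * h (m + k))" for m
  proof -
    have S: "summable (\<lambda>k. (- (w\<^sup>2)) ^ k / fact k * h (m + k))"
      by (rule summable_norm_cancel[OF bessel_series_summable(1)[OF R]])
    have "bessel_J (\<alpha> + of_nat m) z
        = (\<Sum>k. w powr \<alpha> * w ^ m * ((- (w\<^sup>2)) ^ k / fact k * h (m + k)))"
      unfolding bessel_J_power_series[OF z] w_def[symmetric] powr_add_nat[OF w] h_def
      by (simp add: ac_simps)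
    also have "\<dots> = w powr \<alpha> * w ^ m * (\<Sum>k. (- (w\<^sup>2)) ^ k / fact k * h (m + k))"
      by (rule suminf_mult[OF S])
    finally have "w ^ m / fact m * bessel_J (\<alpha> + of_nat m) z =
        w powr \<alpha> * ((w\<^sup>2) ^ m / fact m * (\<Sum>k. (- (w\<^sup>2)) ^ k / fact k * h (m + k)))"
      by (simp add: power2_eq_square power_mult_distrib)
    then show ?thesis
      by (simp only: suminf_mult[OF S] mult.assoc)
  qed
  have "rGamma (\<alpha> + 1) = h 0"
    by (simp add: h_def)
  then show ?thesis
    unfolding w_def[symmetric] rows
    by (simp only: sums_mult[OF antidiagonal_collapse[where h = h, OF R]])
qed

section \<open>The expansion\<close>

theorem theorem2p7:
  fixes b c \<rho> \<nu> \<mu> z :: complex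
  assumes "Re \<rho> > 0" and "Re \<nu> > -1" and "Re \<mu> > -1" and "\<mu> \<noteq> \<nu>"
    and "z \<notin> \<real>\<^sub>\<le>\<^sub>0"
  shows "summable (unified_bessel_term b c \<rho> \<nu> z) \<and>
    (\<forall>m. summable (\<lambda>n. double_series_term b c \<rho> \<nu> \<mu> z m n)) \<and>
    summable (\<lambda>m. \<Sum>n. double_series_term b c \<rho> \<nu> \<mu> z m n) \<and>
    unified_bessel b c \<rho> \<nu> z =
      Gamma (\<mu> + 1) / (Gamma (\<nu> + 1))\<^sup>2 *
        (\<Sum>m. \<Sum>n. double_series_term b c \<rho> \<nu> \<mu> z m n)"
proof -
  define w where "w = z / 2"
  have z: "z \<noteq> 0"
    using assms(5) by auto
  then have w: "w \<noteq> 0"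
    by (simp add: w_def)
  have \<nu>: "Re (\<nu> + 1) > 0" and \<mu>: "Re (\<mu> + 1) > 0"
    using assms by auto
  note pn = pochhammer_nonzero[OF \<nu>]
  define F where "F = double_series_term b c \<rho> \<nu> \<mu> z"
  define C where "C n = w powr (\<nu> - \<mu>) * w ^ n * (- b) ^ n * gen_pochhammer c \<rho> (\<nu> + of_nat (2 * n)) *
      pochhammer (\<mu> + 1) n / (fact n * pochhammer (\<nu> + 1) n * pochhammer (\<nu> + 1) (2 * n))" for n
  \<comment> \<open>All dependence on \<open>m\<close> is concentrated in one factor, a summand of the expansion of a power
    in Bessel functions.\<close>
  have F: "F m n = C n * (w ^ m / fact m * bessel_J (\<mu> + of_nat n + of_nat m) z)" for m n
  proof -
    have "(-1) ^ n * pochhammer (- of_nat m - of_nat n) n = pochhammer (of_nat m + 1 :: complex) n"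
      using pochhammer_minus'[of "of_nat m + of_nat n :: complex" n] by (simp add: algebra_simps)
    moreover have "fact (m + n) = fact m * pochhammer (of_nat m + 1 :: complex) n"
      using pochhammer_product'[of "1 :: complex" m n] by (simp add: pochhammer_fact add.commute)
    moreover have "pochhammer (of_nat m + 1 :: complex) n \<noteq> 0"
      by (rule pochhammer_nonzero) simp
    moreover have "w powr (\<nu> - \<mu> + of_nat m + of_nat n) = w powr (\<nu> - \<mu>) * w ^ m * w ^ n"
      by (simp add: powr_add_nat[OF w])
    ultimately show ?thesis
      using pn[of n] pn[of "2 * n"]
      unfolding F_def double_series_term_def C_def w_def[symmetric]
      by (simp add: field_simps)
  qed
  obtain R where R: "\<And>j. norm (rGamma (\<mu> + 1 + of_nat j)) \<le> R"
    using rGamma_shift_bounded[OF \<mu>] by blast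
  obtain K A where KA: "K \<ge> 0" "A \<ge> 0"
    "\<And>n. norm (gen_pochhammer c \<rho> (\<nu> + of_nat n)) \<le> K * A ^ n * norm (pochhammer (\<nu> + 1) n)"
    using gen_pochhammer_growth[OF assms(1) \<nu>] by blast
  define B where "B = 1 + norm (\<mu> + 1 - (\<nu> + 1)) / Re (\<nu> + 1)"
  have B: "B \<ge> 0" "norm (pochhammer (\<mu> + 1) n) \<le> B ^ n * norm (pochhammer (\<nu> + 1) n)" for n
    using norm_pochhammer_le[OF \<nu>, of "\<mu> + 1" n] \<nu> by (simp_all add: B_def)
  define x where "x = norm w"
  define L where "L = norm (w powr \<mu>) * (exp (norm (w\<^sup>2)) * R)"
  have L: "L \<ge> 0"
    using order_trans[OF norm_ge_zero R[of 0]] by (simp add: L_def)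
  define D where "D = norm (w powr (\<nu> - \<mu>)) * K * L"
  have D: "D \<ge> 0"
    using KA L by (simp add: D_def)
  \<comment> \<open>One power \<open>x^m\<close> comes from the explicit factor and a second one from \<open>J_{\<mu>+n+m}\<close>.\<close>
  have J: "norm (w ^ m / fact m * bessel_J (\<mu> + of_nat n + of_nat m) z)
      \<le> (x\<^sup>2) ^ m / fact m * (L * x ^ n)" for m n
  proof -
    have "norm (bessel_J (\<mu> + of_nat n + of_nat m) z) \<le> L * x ^ (n + m)"
      using norm_bessel_J_shift_le[OF z R, of "n + m"] by (simp add: L_def x_def w_def mult_ac add_ac)
    then have "x ^ m / fact m * norm (bessel_J (\<mu> + of_nat n + of_nat m) z)
        \<le> x ^ m / fact m * (L * x ^ (n + m))"
      by (rule mult_left_mono) (simp add: x_def)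
    then show ?thesis
      by (simp add: norm_mult norm_divide norm_power x_def power_add power2_eq_square power_mult_distrib mult_ac)
  qed
  \<comment> \<open>The generalized Pochhammer symbol is divided by \<open>(\<nu>+1)_{2n}\<close>, and \<open>(\<mu>+1)_n\<close> by \<open>(\<nu>+1)_n\<close>; each
    quotient grows at most geometrically.\<close>
  have Cb: "norm (C n) \<le> norm (w powr (\<nu> - \<mu>)) * x ^ n * norm b ^ n * (K * A ^ (2 * n)) * B ^ n / fact n" for n
  proof -
    have g: "norm (gen_pochhammer c \<rho> (\<nu> + of_nat (2 * n))) / norm (pochhammer (\<nu> + 1) (2 * n)) \<le> K * A ^ (2 * n)"
      using KA(3)[of "2 * n"] pn[of "2 * n"] by (simp add: divide_le_eq)
    have q: "norm (pochhammer (\<mu> + 1) n) / norm (pochhammer (\<nu> + 1) n) \<le> B ^ n"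
      using B(2)[of n] pn[of n] by (simp add: divide_le_eq)
    have "norm (C n) = norm (w powr (\<nu> - \<mu>)) * x ^ n * norm b ^ n / fact n *
       ((norm (gen_pochhammer c \<rho> (\<nu> + of_nat (2 * n))) / norm (pochhammer (\<nu> + 1) (2 * n))) *
        (norm (pochhammer (\<mu> + 1) n) / norm (pochhammer (\<nu> + 1) n)))"
      by (simp add: C_def norm_mult norm_divide norm_power x_def mult_ac)
    also have "\<dots> \<le> norm (w powr (\<nu> - \<mu>)) * x ^ n * norm b ^ n / fact n * ((K * A ^ (2 * n)) * B ^ n)"
      by (intro mult_left_mono mult_mono g q) (use KA B in \<open>auto simp: x_def\<close>)
    finally show ?thesis
      by (simp add: mult_ac)
  qed
  have Fs: "(\<lambda>(m, n). F m n) summable_on UNIV \<times> UNIV"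
  proof (rule product_majorant_summable_on)
    fix m n
    have "norm (F m n) \<le> (norm (w powr (\<nu> - \<mu>)) * x ^ n * norm b ^ n * (K * A ^ (2 * n)) * B ^ n / fact n) *
       ((x\<^sup>2) ^ m / fact m * (L * x ^ n))"
      unfolding F norm_mult[of "C n"]
      by (rule mult_mono[OF Cb J]) (use KA B in \<open>auto simp: x_def\<close>)
    also have "\<dots> = (x\<^sup>2) ^ m / fact m * (D * ((x\<^sup>2 * norm b * A\<^sup>2 * B) ^ n / fact n))"
      by (simp add: D_def power_mult_distrib power_mult power2_eq_square mult_ac)
    finally show "norm (F m n) \<le> (x\<^sup>2) ^ m / fact m * (D * ((x\<^sup>2 * norm b * A\<^sup>2 * B) ^ n / fact n))" .
  next
    have e: "summable (\<lambda>n. r ^ n / fact n)" for r :: real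
      using summable_exp[of r] by (simp add: field_simps)
    show "summable (\<lambda>m. (x\<^sup>2) ^ m / fact m)"
      by (rule e)
    show "summable (\<lambda>n. D * ((x\<^sup>2 * norm b * A\<^sup>2 * B) ^ n / fact n))"
      by (rule summable_mult[OF e])
  qed (use D B KA in \<open>auto simp: x_def\<close>)
  define k where "k = Gamma (\<mu> + 1) / (Gamma (\<nu> + 1))\<^sup>2"
  have column: "k * (\<Sum>m. F m n) = unified_bessel_term b c \<rho> \<nu> z n" for n
  proof -
    have l: "Re (\<mu> + of_nat n) > -1"
      using \<mu> by simp
    have "(\<lambda>m. F m n) sums (C n * (w powr (\<mu> + of_nat n) * rGamma (\<mu> + 1 + of_nat n)))"
      unfolding F using sums_mult[OF bessel_J_shift_sums[OF z l], of "C n"] by (simp add: w_def add_ac)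
    then have S: "(\<Sum>m. F m n) = C n * (w powr (\<mu> + of_nat n) * rGamma (\<mu> + 1 + of_nat n))"
      by (simp add: sums_iff)
    have "\<mu> + 1 \<notin> \<int>\<^sub>\<le>\<^sub>0"
    proof
      assume "\<mu> + 1 \<in> \<int>\<^sub>\<le>\<^sub>0"
      then obtain j where "\<mu> + 1 = - of_nat j"
        by (rule nonpos_Ints_cases')
      with \<mu> show False
        by simp
    qed
    then have g: "Gamma (\<mu> + 1) * rGamma (\<mu> + 1) = 1"
      by (simp add: Gamma_def rGamma_eq_zero_iff)
    have e: "w powr (\<nu> - \<mu>) * w powr \<mu> = w powr \<nu>"
      by (simp flip: powr_add)
    have "2 * of_nat n + \<nu> = \<nu> + of_nat (n + n)"
      by simp
    then have p: "w powr (2 * of_nat n + \<nu>) = w powr \<nu> * w ^ n * w ^ n"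
      by (simp only: powr_add_nat[OF w] power_add mult.assoc)
    have q: "rGamma (\<nu> + of_nat n + 1) = rGamma (\<nu> + 1) / pochhammer (\<nu> + 1) n"
      "rGamma (\<nu> + 2 * of_nat n + 1) = rGamma (\<nu> + 1) / pochhammer (\<nu> + 1) (2 * n)"
      using rGamma_shift[OF \<nu>, of n] rGamma_shift[OF \<nu>, of "2 * n"] by (simp_all add: add_ac)
    have "k * (\<Sum>m. F m n) = (Gamma (\<mu> + 1) * rGamma (\<mu> + 1)) * (w powr (\<nu> - \<mu>) * w powr \<mu>) *
        (rGamma (\<nu> + 1))\<^sup>2 * w ^ n * w ^ n * (- b) ^ n * gen_pochhammer c \<rho> (\<nu> + of_nat (2 * n)) /
        (fact n * pochhammer (\<nu> + 1) n * pochhammer (\<nu> + 1) (2 * n))"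
      unfolding S k_def C_def rGamma_shift[OF \<mu>] powr_add_nat[OF w]
      using pochhammer_nonzero[OF \<mu>, of n]
      by (simp add: rGamma_inverse_Gamma power_inverse divide_inverse mult_ac)
    also have "\<dots> = unified_bessel_term b c \<rho> \<nu> z n"
      unfolding g e unified_bessel_term_def w_def[symmetric] p q
      by (simp add: power2_eq_square add.commute[of \<nu>] divide_inverse mult_ac)
    finally show ?thesis .
  qed
  have U: "unified_bessel_term b c \<rho> \<nu> z sums (k * (\<Sum>m. \<Sum>n. F m n))"
    using sums_mult[OF iterated_sums_swap[OF Fs], of k] by (simp add: column)
  show ?thesis
    using U iterated_sums[OF Fs]
    by (auto simp: sums_iff unified_bessel_def F_def k_def)
qed

end
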